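(* Let $X$ be a normal complex space, and let $A$ be a locally complete intersection or a normal analytic set in $X$ with (reduced) ideal sheaf $\mathscr{J}_A$. Let $\sigma\colon\tilde X\to X$ denote the blow up of $X$ with center $A$, i.e. the monoidal transformation with respect to $\mathscr{J}_A$, and let $\mathscr{J}_B$ be the (reduced) ideal sheaf associated to the reduced exceptional set $B:=\sigma^{-1}(A)$. Then $\mathscr{J}_A\cong\sigma_*\mathscr{J}_B$.
   Context: The analytic set $A$ is a (nowhere dense) closed analytic subset with its reduced structure; it is a locally complete intersection if its reduced ideal sheaf is locally generated by $\operatorname{codim}A$ holomorphic functions. A proper modification $\varphi\colon Y\to X$ is a proper surjective holomorphic map of complex spaces which is biholomorphic outside closed analytically rare analytic sets of $Y$ and $X$. The monoidal transformation of $X$ with respect to a coherent analytic sheaf $\mathscr{S}$ is the proper modification $\varphi_{\mathscr{S}}\colon X_{\mathscr{S}}\to X$, with $X_{\mathscr{S}}$ reduced, unique up to biholomorphism, such that (1) the sheaf $\varphi_{\mathscr{S}}^*\mathscr{S}$ modulo torsion is locally free, and (2) any proper modification $\pi\colon Y\to X$ for which $\pi^*\mathscr{S}$ modulo torsion is locally free factors uniquely through $\varphi_{\mathscr{S}}$. It exists by a theorem of Rossi and is biholomorphic over the set where $\mathscr{S}$ is locally free. *)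

theory Defs
  imports "HOL-Analysis.Analysis" "HOL-Algebra.AbelCoset" "HOL-Algebra.Module"
begin

section \<open>Reduced complex spaces\<close>

text \<open>
  All complex spaces here are reduced, so the structure sheaf is a sheaf of complex-valued
  functions: \<open>hol X U\<close> is the ring of sections over the open set \<open>U\<close>, each section being
  \<open>extensional\<close> (arbitrary but fixed outside \<open>U\<close>).  A normal complex space is reduced, and
  nothing is lost for the proper modifications of a reduced space \<open>X\<close>:  if \<open>Y \<rightarrow> X\<close> is
  biholomorphic outside an analytically rare set \<open>E\<close>, i.e. all restrictions
  \<open>O(U) \<rightarrow> O(U - E)\<close> are injective, then nilpotents of \<open>O(U)\<close> restrict to \<open>0\<close> on \<open>U - E\<close> and
  hence vanish, so \<open>Y\<close> is reduced.
\<close>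

record 'a cspace =
  ctop :: "'a topology"
  hol :: "'a set \<Rightarrow> ('a \<Rightarrow> complex) set"

text \<open>The dimension of a chart varies from point to point, so complex \<open>n\<close>-space is taken to be the
  coordinate subspace \<open>Cn n\<close> of \<open>nat \<Rightarrow> complex\<close> (product topology), which induces on it the
  Euclidean topology.\<close>

definition Cn :: "nat \<Rightarrow> (nat \<Rightarrow> complex) set" where
  "Cn n = {z. \<forall>i\<ge>n. z i = 0}"

definition holo_on :: "nat \<Rightarrow> ((nat \<Rightarrow> complex) \<Rightarrow> complex) \<Rightarrow> (nat \<Rightarrow> complex) set \<Rightarrow> bool" where
  "holo_on n f W \<longleftrightarrow> openin (top_of_set (Cn n)) W \<and> continuous_on W f \<and>
     (\<forall>z\<in>W. \<forall>i<n. (\<lambda>w. f (z(i := w))) field_differentiable at (z i))"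

definition local_model :: "nat \<Rightarrow> (nat \<Rightarrow> complex) set \<Rightarrow> bool" where
  "local_model n V \<longleftrightarrow> (\<exists>W F. openin (top_of_set (Cn n)) W \<and> finite F \<and>
     (\<forall>f\<in>F. holo_on n f W) \<and> V = {z\<in>W. \<forall>f\<in>F. f z = 0})"

definition chart :: "'a cspace \<Rightarrow> 'a set \<Rightarrow> nat \<Rightarrow> (nat \<Rightarrow> complex) set \<Rightarrow> ('a \<Rightarrow> nat \<Rightarrow> complex) \<Rightarrow> bool"
  where
  "chart X U n V \<phi> \<longleftrightarrow> openin (ctop X) U \<and> local_model n V \<and>
     homeomorphic_map (subtopology (ctop X) U) (top_of_set V) \<phi> \<and>
     (\<forall>W. openin (ctop X) W \<longrightarrow> W \<subseteq> U \<longrightarrow>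
        hol X W = {f \<in> extensional W. \<forall>x\<in>W. \<exists>D g. \<phi> x \<in> D \<and> holo_on n g D \<and>
                      (\<forall>y\<in>W. \<phi> y \<in> D \<longrightarrow> f y = g (\<phi> y))})"

definition complex_space :: "'a cspace \<Rightarrow> bool" where
  "complex_space X \<longleftrightarrow> Hausdorff_space (ctop X) \<and>
     (\<forall>U. openin (ctop X) U \<longrightarrow> hol X U \<subseteq> extensional U) \<and>
     (\<forall>U V f. openin (ctop X) U \<longrightarrow> openin (ctop X) V \<longrightarrow> V \<subseteq> U \<longrightarrow> f \<in> hol X U \<longrightarrow>
        restrict f V \<in> hol X V) \<and>
     (\<forall>U f. openin (ctop X) U \<longrightarrow> f \<in> extensional U \<longrightarrow>
        (\<forall>x\<in>U. \<exists>V. openin (ctop X) V \<and> x \<in> V \<and> V \<subseteq> U \<and> restrict f V \<in> hol X V) \<longrightarrow>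
        f \<in> hol X U) \<and>
     (\<forall>x\<in>topspace (ctop X). \<exists>U n V \<phi>. x \<in> U \<and> chart X U n V \<phi>)"

definition open_subspace :: "'a cspace \<Rightarrow> 'a set \<Rightarrow> 'a cspace" where
  "open_subspace X U = \<lparr>ctop = subtopology (ctop X) U, hol = hol X\<rparr>"

definition preim :: "'b cspace \<Rightarrow> ('b \<Rightarrow> 'a) \<Rightarrow> 'a set \<Rightarrow> 'b set" where
  "preim Y \<phi> U = {y \<in> topspace (ctop Y). \<phi> y \<in> U}"

definition pull :: "'b cspace \<Rightarrow> ('b \<Rightarrow> 'a) \<Rightarrow> 'a set \<Rightarrow> ('a \<Rightarrow> complex) \<Rightarrow> 'b \<Rightarrow> complex" where
  "pull Y \<phi> U f = restrict (f \<circ> \<phi>) (preim Y \<phi> U)"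

definition holomorphic_map :: "'b cspace \<Rightarrow> 'a cspace \<Rightarrow> ('b \<Rightarrow> 'a) \<Rightarrow> bool" where
  "holomorphic_map Y X \<phi> \<longleftrightarrow> continuous_map (ctop Y) (ctop X) \<phi> \<and>
     (\<forall>U f. openin (ctop X) U \<longrightarrow> f \<in> hol X U \<longrightarrow> pull Y \<phi> U f \<in> hol Y (preim Y \<phi> U))"

definition biholomorphic_map :: "'b cspace \<Rightarrow> 'a cspace \<Rightarrow> ('b \<Rightarrow> 'a) \<Rightarrow> bool" where
  "biholomorphic_map Y X \<phi> \<longleftrightarrow> holomorphic_map Y X \<phi> \<and>
     (\<exists>\<psi>. holomorphic_map X Y \<psi> \<and> (\<forall>y\<in>topspace (ctop Y). \<psi> (\<phi> y) = y) \<and>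
          (\<forall>x\<in>topspace (ctop X). \<phi> (\<psi> x) = x))"


section \<open>Analytic sets, normality, complete intersections\<close>

text \<open>Closedness follows, since the local condition is imposed at every point of the space.\<close>

definition analytic_set :: "'a cspace \<Rightarrow> 'a set \<Rightarrow> bool" where
  "analytic_set X A \<longleftrightarrow> A \<subseteq> topspace (ctop X) \<and>
     (\<forall>x\<in>topspace (ctop X). \<exists>U F. openin (ctop X) U \<and> x \<in> U \<and> finite F \<and> F \<subseteq> hol X U \<and>
        A \<inter> U = {y\<in>U. \<forall>f\<in>F. f y = 0})"

text \<open>On a reduced space, a closed analytic set is analytically rare iff it is nowhere dense.\<close>

definition rare_analytic_set :: "'a cspace \<Rightarrow> 'a set \<Rightarrow> bool" where
  "rare_analytic_set X A \<longleftrightarrow> analytic_set X A \<and> (ctop X) interior_of A = {}"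

definition reduced_subspace :: "'a cspace \<Rightarrow> 'a set \<Rightarrow> 'a cspace" where
  "reduced_subspace X A = \<lparr>ctop = subtopology (ctop X) A,
     hol = (\<lambda>W. {f \<in> extensional W. \<forall>x\<in>W. \<exists>U g. openin (ctop X) U \<and> x \<in> U \<and> g \<in> hol X U \<and>
                  (\<forall>y\<in>U \<inter> W. f y = g y)})\<rparr>"

definition weakly_holomorphic :: "'a cspace \<Rightarrow> 'a set \<Rightarrow> 'a set \<Rightarrow> ('a \<Rightarrow> complex) \<Rightarrow> bool" where
  "weakly_holomorphic X U N f \<longleftrightarrow> rare_analytic_set (open_subspace X U) N \<and> f \<in> hol X (U - N) \<and>
     (\<forall>x\<in>U. \<exists>V M. openin (ctop X) V \<and> x \<in> V \<and> V \<subseteq> U \<and> (\<forall>y\<in>V - N. cmod (f y) \<le> M))"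

text \<open>Normality in the usual function-theoretic sense (the sheaf of weakly holomorphic functions
  is the structure sheaf), where a weakly holomorphic function is one that is holomorphic outside a
  nowhere dense analytic set and locally bounded along it.\<close>

definition normal_complex_space :: "'a cspace \<Rightarrow> bool" where
  "normal_complex_space X \<longleftrightarrow> complex_space X \<and>
     (\<forall>U N f. openin (ctop X) U \<longrightarrow> weakly_holomorphic X U N f \<longrightarrow>
        (\<exists>g\<in>hol X U. \<forall>y\<in>U - N. g y = f y))"

text \<open>The analytic dimension at \<open>x\<close>: the least number of holomorphic functions near \<open>x\<close> of
  which \<open>x\<close> is an isolated common zero.\<close>

definition dim_at :: "'a cspace \<Rightarrow> 'a \<Rightarrow> nat" where
  "dim_at X x = (LEAST k. \<exists>U f. openin (ctop X) U \<and> x \<in> U \<and> (\<forall>i<k. f i \<in> hol X U) \<and>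
                   {y\<in>U. \<forall>i<k. f i y = (0::complex)} = {x})"

definition codim_at :: "'a cspace \<Rightarrow> 'a set \<Rightarrow> 'a \<Rightarrow> nat" where
  "codim_at X A x = dim_at X x - dim_at (reduced_subspace X A) x"

definition ideal_sections :: "'a cspace \<Rightarrow> 'a set \<Rightarrow> 'a set \<Rightarrow> ('a \<Rightarrow> complex) set" where
  "ideal_sections X A U = {f \<in> hol X U. \<forall>x\<in>U \<inter> A. f x = 0}"

text \<open>Generation is generation of the ideal sheaf, i.e. of all its stalks over \<open>U\<close>.\<close>

definition generates_ideal ::
  "'a cspace \<Rightarrow> 'a set \<Rightarrow> 'a set \<Rightarrow> nat \<Rightarrow> (nat \<Rightarrow> 'a \<Rightarrow> complex) \<Rightarrow> bool" where
  "generates_ideal X A U r f \<longleftrightarrow> (\<forall>i<r. f i \<in> ideal_sections X A U) \<and>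
     (\<forall>W h y. openin (ctop X) W \<longrightarrow> W \<subseteq> U \<longrightarrow> h \<in> ideal_sections X A W \<longrightarrow> y \<in> W \<longrightarrow>
        (\<exists>V a. openin (ctop X) V \<and> y \<in> V \<and> V \<subseteq> W \<and> (\<forall>i<r. a i \<in> hol X V) \<and>
           (\<forall>z\<in>V. h z = (\<Sum>i<r. a i z * f i z))))"

definition locally_complete_intersection :: "'a cspace \<Rightarrow> 'a set \<Rightarrow> bool" where
  "locally_complete_intersection X A \<longleftrightarrow> analytic_set X A \<and>
     (\<forall>x\<in>A. \<exists>U f. openin (ctop X) U \<and> x \<in> U \<and> generates_ideal X A U (codim_at X A x) f)"


section \<open>Sheaves of modules\<close>

text \<open>
  A sheaf of modules on \<open>X\<close> consists of its modules of sections \<open>Sec F U\<close> over \<open>hol X U\<close> and its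
  restriction maps \<open>Res F U V\<close> for \<open>V \<subseteq> U\<close>; only open \<open>U\<close>, \<open>V\<close> matter.  Modules are records of
  \<open>HOL-Algebra\<close>; these extend ring records, so that the structure sheaf itself, with its
  multiplication, is an instance.  For other modules the fields \<open>mult\<close> and \<open>one\<close> are irrelevant.
\<close>

record ('a, 's) msheaf =
  Sec :: "'a set \<Rightarrow> ('a \<Rightarrow> complex, 's) module"
  Res :: "'a set \<Rightarrow> 'a set \<Rightarrow> 's \<Rightarrow> 's"

definition structure_sheaf :: "'a cspace \<Rightarrow> ('a, 'a \<Rightarrow> complex) msheaf" where
  "structure_sheaf X = \<lparr>
     Sec = (\<lambda>U. \<lparr>carrier = hol X U,
                 mult = (\<lambda>f g. \<lambda>x\<in>U. f x * g x), one = (\<lambda>x\<in>U. 1),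
                 zero = (\<lambda>x\<in>U. 0), add = (\<lambda>f g. \<lambda>x\<in>U. f x + g x),
                 smult = (\<lambda>f g. \<lambda>x\<in>U. f x * g x)\<rparr>),
     Res = (\<lambda>U V f. restrict f V)\<rparr>"

definition ideal_sheaf :: "'a cspace \<Rightarrow> 'a set \<Rightarrow> ('a, 'a \<Rightarrow> complex) msheaf" where
  "ideal_sheaf X A = \<lparr>
     Sec = (\<lambda>U. (Sec (structure_sheaf X) U)\<lparr>carrier := ideal_sections X A U\<rparr>),
     Res = Res (structure_sheaf X)\<rparr>"

definition sheaf_isomorphism ::
  "'a cspace \<Rightarrow> ('a, 's) msheaf \<Rightarrow> ('a, 't) msheaf \<Rightarrow> ('a set \<Rightarrow> 's \<Rightarrow> 't) \<Rightarrow> bool" where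
  "sheaf_isomorphism X F G \<theta> \<longleftrightarrow>
     (\<forall>U. openin (ctop X) U \<longrightarrow>
        bij_betw (\<theta> U) (carrier (Sec F U)) (carrier (Sec G U)) \<and>
        (\<forall>s\<in>carrier (Sec F U). \<forall>t\<in>carrier (Sec F U).
           \<theta> U (s \<oplus>\<^bsub>Sec F U\<^esub> t) = \<theta> U s \<oplus>\<^bsub>Sec G U\<^esub> \<theta> U t) \<and>
        (\<forall>f\<in>hol X U. \<forall>s\<in>carrier (Sec F U).
           \<theta> U (f \<odot>\<^bsub>Sec F U\<^esub> s) = f \<odot>\<^bsub>Sec G U\<^esub> \<theta> U s) \<and>
        (\<forall>V. openin (ctop X) V \<longrightarrow> V \<subseteq> U \<longrightarrow>
           (\<forall>s\<in>carrier (Sec F U). \<theta> V (Res F U V s) = Res G U V (\<theta> U s))))"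

definition sheaf_isomorphic :: "'a cspace \<Rightarrow> ('a, 's) msheaf \<Rightarrow> ('a, 't) msheaf \<Rightarrow> bool" where
  "sheaf_isomorphic X F G \<longleftrightarrow> (\<exists>\<theta>. sheaf_isomorphism X F G \<theta>)"

text \<open>The direct image is a module over the structure sheaf of the target by composition.\<close>

definition direct_image :: "'b cspace \<Rightarrow> ('b \<Rightarrow> 'a) \<Rightarrow> ('b, 's) msheaf \<Rightarrow> ('a, 's) msheaf" where
  "direct_image Y \<phi> F = \<lparr>
     Sec = (\<lambda>U. let M = Sec F (preim Y \<phi> U) in
              \<lparr>carrier = carrier M, mult = mult M, one = one M, zero = zero M, add = add M,
               smult = (\<lambda>f s. pull Y \<phi> U f \<odot>\<^bsub>M\<^esub> s)\<rparr>),
     Res = (\<lambda>U V. Res F (preim Y \<phi> U) (preim Y \<phi> V))\<rparr>"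

definition free_sheaf :: "'a cspace \<Rightarrow> nat \<Rightarrow> ('a, nat \<Rightarrow> 'a \<Rightarrow> complex) msheaf" where
  "free_sheaf X r = \<lparr>
     Sec = (\<lambda>U. let R = Sec (structure_sheaf X) U in
              \<lparr>carrier = {..<r} \<rightarrow>\<^sub>E carrier R, mult = undefined, one = undefined,
               zero = (\<lambda>i\<in>{..<r}. \<zero>\<^bsub>R\<^esub>), add = (\<lambda>s t. \<lambda>i\<in>{..<r}. s i \<oplus>\<^bsub>R\<^esub> t i),
               smult = (\<lambda>f s. \<lambda>i\<in>{..<r}. f \<otimes>\<^bsub>R\<^esub> s i)\<rparr>),
     Res = (\<lambda>U V s. \<lambda>i\<in>{..<r}. restrict (s i) V)\<rparr>"

definition locally_free :: "'a cspace \<Rightarrow> ('a, 's) msheaf \<Rightarrow> bool" where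
  "locally_free X F \<longleftrightarrow> (\<forall>x\<in>topspace (ctop X). \<exists>U r. openin (ctop X) U \<and> x \<in> U \<and>
     sheaf_isomorphic (open_subspace X U) (free_sheaf X r) F)"


section \<open>Stalks\<close>

definition germ :: "'a cspace \<Rightarrow> ('a, 's) msheaf \<Rightarrow> 'a \<Rightarrow> 'a set \<Rightarrow> 's \<Rightarrow> ('a set \<times> 's) set" where
  "germ X F x U s = {(V, t). openin (ctop X) V \<and> x \<in> V \<and> t \<in> carrier (Sec F V) \<and>
     (\<exists>W. openin (ctop X) W \<and> x \<in> W \<and> W \<subseteq> U \<inter> V \<and> Res F U W s = Res F V W t)}"

text \<open>An operation on sections, transferred to germs: all the germs in the union coincide.\<close>

definition germ_op ::
  "'a cspace \<Rightarrow> ('a, 's) msheaf \<Rightarrow> ('a, 't) msheaf \<Rightarrow> 'a \<Rightarrow> ('a set \<Rightarrow> 's \<Rightarrow> 't \<Rightarrow> 't) \<Rightarrow>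
   ('a set \<times> 's) set \<Rightarrow> ('a set \<times> 't) set \<Rightarrow> ('a set \<times> 't) set" where
  "germ_op X G F x oper c d = (\<Union>(U, s)\<in>c. \<Union>(V, t)\<in>d.
     germ X F x (U \<inter> V) (oper (U \<inter> V) (Res G U (U \<inter> V) s) (Res F V (U \<inter> V) t)))"

definition stalk ::
  "'a cspace \<Rightarrow> ('a, 's) msheaf \<Rightarrow> 'a \<Rightarrow>
   (('a set \<times> ('a \<Rightarrow> complex)) set, ('a set \<times> 's) set) module" where
  "stalk X F x = \<lparr>
     carrier = {germ X F x U s | U s. openin (ctop X) U \<and> x \<in> U \<and> s \<in> carrier (Sec F U)},
     mult = germ_op X F F x (\<lambda>W. mult (Sec F W)),
     one = germ X F x (topspace (ctop X)) (one (Sec F (topspace (ctop X)))),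
     zero = germ X F x (topspace (ctop X)) (zero (Sec F (topspace (ctop X)))),
     add = germ_op X F F x (\<lambda>W. add (Sec F W)),
     smult = germ_op X (structure_sheaf X) F x (\<lambda>W. smult (Sec F W))\<rparr>"

abbreviation local_ring ::
  "'a cspace \<Rightarrow> 'a \<Rightarrow>
   (('a set \<times> ('a \<Rightarrow> complex)) set, ('a set \<times> ('a \<Rightarrow> complex)) set) module" where
  "local_ring X x \<equiv> stalk X (structure_sheaf X) x"

text \<open>The sheaf with prescribed stalks \<open>M y\<close> whose sections are the functions with values in the
  stalks which locally belong to the prescribed sets \<open>P V\<close>, i.e. the sheaf associated to the
  presheaf \<open>P\<close> by its espace etale.\<close>

definition stalkwise_sheaf ::
  "'b cspace \<Rightarrow> ('b \<Rightarrow> (('b set \<times> ('b \<Rightarrow> complex)) set, 'm) module) \<Rightarrow> ('b set \<Rightarrow> ('b \<Rightarrow> 'm) set) \<Rightarrow>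
   ('b, 'b \<Rightarrow> 'm) msheaf" where
  "stalkwise_sheaf Y M P = \<lparr>
     Sec = (\<lambda>U. \<lparr>
       carrier = {s \<in> extensional U. (\<forall>y\<in>U. s y \<in> carrier (M y)) \<and>
          (\<forall>y\<in>U. \<exists>V. openin (ctop Y) V \<and> y \<in> V \<and> V \<subseteq> U \<and> (\<exists>t\<in>P V. \<forall>z\<in>V. s z = t z))},
       mult = undefined, one = undefined,
       zero = (\<lambda>y\<in>U. \<zero>\<^bsub>M y\<^esub>), add = (\<lambda>s t. \<lambda>y\<in>U. s y \<oplus>\<^bsub>M y\<^esub> t y),
       smult = (\<lambda>f s. \<lambda>y\<in>U. germ Y (structure_sheaf Y) y U f \<odot>\<^bsub>M y\<^esub> s y)\<rparr>),
     Res = (\<lambda>U V s. restrict s V)\<rparr>"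


section \<open>Analytic inverse image\<close>

text \<open>
  For a ring homomorphism \<open>h: R \<rightarrow> B\<close> and an \<open>R\<close>-module \<open>N\<close>, the \<open>B\<close>-module
  \<open>B \<otimes>\<^sub>R N\<close> is constructed as the free commutative monoid on \<open>B \<times> N\<close> modulo the tensor
  relations: a list \<open>[(b1, n1), ..., (bk, nk)]\<close> represents the sum of the \<open>bi \<otimes> ni\<close>.
\<close>

inductive tensor_rel ::
  "('r, 'p) ring_scheme \<Rightarrow> ('b, 'q) ring_scheme \<Rightarrow> ('r \<Rightarrow> 'b) \<Rightarrow> ('r, 'n) module \<Rightarrow>
   ('b \<times> 'n) list \<Rightarrow> ('b \<times> 'n) list \<Rightarrow> bool"
  for R B h N where
  refl: "xs \<in> lists (carrier B \<times> carrier N) \<Longrightarrow> tensor_rel R B h N xs xs"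
| sym: "tensor_rel R B h N xs ys \<Longrightarrow> tensor_rel R B h N ys xs"
| trans: "tensor_rel R B h N xs ys \<Longrightarrow> tensor_rel R B h N ys zs \<Longrightarrow> tensor_rel R B h N xs zs"
| append: "tensor_rel R B h N xs xs' \<Longrightarrow> tensor_rel R B h N ys ys' \<Longrightarrow>
    tensor_rel R B h N (xs @ ys) (xs' @ ys')"
| comm: "xs \<in> lists (carrier B \<times> carrier N) \<Longrightarrow> ys \<in> lists (carrier B \<times> carrier N) \<Longrightarrow>
    tensor_rel R B h N (xs @ ys) (ys @ xs)"
| zero: "n \<in> carrier N \<Longrightarrow> tensor_rel R B h N [(\<zero>\<^bsub>B\<^esub>, n)] []"
| add_left: "b \<in> carrier B \<Longrightarrow> b' \<in> carrier B \<Longrightarrow> n \<in> carrier N \<Longrightarrow>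
    tensor_rel R B h N [(b \<oplus>\<^bsub>B\<^esub> b', n)] [(b, n), (b', n)]"
| add_right: "b \<in> carrier B \<Longrightarrow> n \<in> carrier N \<Longrightarrow> n' \<in> carrier N \<Longrightarrow>
    tensor_rel R B h N [(b, n \<oplus>\<^bsub>N\<^esub> n')] [(b, n), (b, n')]"
| balanced: "b \<in> carrier B \<Longrightarrow> r \<in> carrier R \<Longrightarrow> n \<in> carrier N \<Longrightarrow>
    tensor_rel R B h N [(b \<otimes>\<^bsub>B\<^esub> h r, n)] [(b, r \<odot>\<^bsub>N\<^esub> n)]"

definition tensor_class ::
  "('r, 'p) ring_scheme \<Rightarrow> ('b, 'q) ring_scheme \<Rightarrow> ('r \<Rightarrow> 'b) \<Rightarrow> ('r, 'n) module \<Rightarrow>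
   ('b \<times> 'n) list \<Rightarrow> ('b \<times> 'n) list set" where
  "tensor_class R B h N xs = {ys. tensor_rel R B h N xs ys}"

definition base_change ::
  "('r, 'p) ring_scheme \<Rightarrow> ('b, 'q) ring_scheme \<Rightarrow> ('r \<Rightarrow> 'b) \<Rightarrow> ('r, 'n) module \<Rightarrow>
   ('b, ('b \<times> 'n) list set) module" where
  "base_change R B h N = \<lparr>
     carrier = tensor_class R B h N ` lists (carrier B \<times> carrier N),
     mult = undefined, one = undefined,
     zero = tensor_class R B h N [],
     add = (\<lambda>c d. \<Union>xs\<in>c. \<Union>ys\<in>d. tensor_class R B h N (xs @ ys)),
     smult = (\<lambda>b c. \<Union>xs\<in>c. tensor_class R B h N (map (\<lambda>(b', n). (b \<otimes>\<^bsub>B\<^esub> b', n)) xs))\<rparr>"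

definition germ_pull ::
  "'b cspace \<Rightarrow> ('b \<Rightarrow> 'a) \<Rightarrow> 'b \<Rightarrow>
   ('a set \<times> ('a \<Rightarrow> complex)) set \<Rightarrow> ('b set \<times> ('b \<Rightarrow> complex)) set" where
  "germ_pull Y \<phi> y c =
     (\<Union>(U, f)\<in>c. germ Y (structure_sheaf Y) y (preim Y \<phi> U) (pull Y \<phi> U f))"

text \<open>A section of \<open>\<phi>\<^sup>*F\<close> is, on small open sets \<open>V\<close>, a finite sum of terms \<open>b \<otimes> \<phi>\<^sup>-\<^sup>1t\<close> with \<open>b\<close> holomorphic on
  \<open>V\<close> and \<open>t\<close> a section of \<open>F\<close> over an open set \<open>W\<close> containing \<open>\<phi>(V)\<close>.\<close>

definition inverse_image ::
  "'b cspace \<Rightarrow> 'a cspace \<Rightarrow> ('b \<Rightarrow> 'a) \<Rightarrow> ('a, 's) msheaf \<Rightarrow>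
   ('b, 'b \<Rightarrow> (('b set \<times> ('b \<Rightarrow> complex)) set \<times> ('a set \<times> 's) set) list set) msheaf" where
  "inverse_image Y X \<phi> F = stalkwise_sheaf Y
     (\<lambda>y. base_change (local_ring X (\<phi> y)) (local_ring Y y) (germ_pull Y \<phi> y) (stalk X F (\<phi> y)))
     (\<lambda>V. {\<lambda>y. tensor_class (local_ring X (\<phi> y)) (local_ring Y y) (germ_pull Y \<phi> y)
                 (stalk X F (\<phi> y))
                 (map (\<lambda>(b, W, t). (germ Y (structure_sheaf Y) y V b, germ X F (\<phi> y) W t)) l)
           | l. \<forall>(b, W, t)\<in>set l. b \<in> hol Y V \<and> openin (ctop X) W \<and> \<phi> ` V \<subseteq> W \<and>
                  t \<in> carrier (Sec F W)})"


section \<open>Torsion\<close>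

definition nonzerodivisor :: "('b, 'q) ring_scheme \<Rightarrow> 'b \<Rightarrow> bool" where
  "nonzerodivisor B b \<longleftrightarrow> b \<in> carrier B \<and> (\<forall>a\<in>carrier B. a \<otimes>\<^bsub>B\<^esub> b = \<zero>\<^bsub>B\<^esub> \<longrightarrow> a = \<zero>\<^bsub>B\<^esub>)"

definition torsion :: "('b, 'q) ring_scheme \<Rightarrow> ('b, 'm) module \<Rightarrow> 'm set" where
  "torsion B M = {m \<in> carrier M. \<exists>b. nonzerodivisor B b \<and> b \<odot>\<^bsub>M\<^esub> m = \<zero>\<^bsub>M\<^esub>}"

definition quotient_module :: "('b, 'm) module \<Rightarrow> 'm set \<Rightarrow> ('b, 'm set) module" where
  "quotient_module M T = \<lparr>
     carrier = a_rcosets\<^bsub>M\<^esub> T, mult = undefined, one = undefined,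
     zero = T, add = set_add M,
     smult = (\<lambda>b c. \<Union>m\<in>c. T +>\<^bsub>M\<^esub> (b \<odot>\<^bsub>M\<^esub> m))\<rparr>"

text \<open>The torsion subsheaf of \<open>F\<close> consists of the torsion submodules of the stalks.\<close>

definition mod_torsion ::
  "'b cspace \<Rightarrow> ('b, 's) msheaf \<Rightarrow> ('b, 'b \<Rightarrow> ('b set \<times> 's) set set) msheaf" where
  "mod_torsion Y F = stalkwise_sheaf Y
     (\<lambda>y. quotient_module (stalk Y F y) (torsion (local_ring Y y) (stalk Y F y)))
     (\<lambda>V. {\<lambda>y. torsion (local_ring Y y) (stalk Y F y) +>\<^bsub>stalk Y F y\<^esub> germ Y F y V t
           | t. t \<in> carrier (Sec F V)})"


section \<open>Proper modifications and monoidal transformations\<close>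

definition proper_modification :: "'b cspace \<Rightarrow> 'a cspace \<Rightarrow> ('b \<Rightarrow> 'a) \<Rightarrow> bool" where
  "proper_modification Y X \<phi> \<longleftrightarrow> complex_space Y \<and> complex_space X \<and>
     holomorphic_map Y X \<phi> \<and> proper_map (ctop Y) (ctop X) \<phi> \<and>
     \<phi> ` topspace (ctop Y) = topspace (ctop X) \<and>
     (\<exists>E N. rare_analytic_set Y E \<and> rare_analytic_set X N \<and>
        biholomorphic_map (open_subspace Y (topspace (ctop Y) - E))
                          (open_subspace X (topspace (ctop X) - N)) \<phi>)"

text \<open>
  The universal property has to be tested on spaces carried by one fixed type.  The type
  \<open>'a \<times> complex\<close> is large enough to be no restriction: the fibres of a proper map are compact,
  hence covered by finitely many charts and at most of the cardinality of the continuum, so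
  every proper modification of \<open>X\<close> is biholomorphic, over \<open>X\<close>, to one carried by a subset of
  \<open>'a \<times> complex\<close>.
\<close>

definition monoidal_transformation ::
  "'b cspace \<Rightarrow> 'a cspace \<Rightarrow> ('b \<Rightarrow> 'a) \<Rightarrow> ('a, 's) msheaf \<Rightarrow> bool" where
  "monoidal_transformation X' X \<phi> S \<longleftrightarrow>
     proper_modification X' X \<phi> \<and>
     locally_free X' (mod_torsion X' (inverse_image X' X \<phi> S)) \<and>
     (\<forall>(Y :: ('a \<times> complex) cspace) \<pi>.
        proper_modification Y X \<pi> \<longrightarrow>
        locally_free Y (mod_torsion Y (inverse_image Y X \<pi> S)) \<longrightarrow>
        (\<exists>!\<psi>. \<psi> \<in> extensional (topspace (ctop Y)) \<and> holomorphic_map Y X' \<psi> \<and>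
              (\<forall>y\<in>topspace (ctop Y). \<phi> (\<psi> y) = \<pi> y)))"

definition blow_up :: "'b cspace \<Rightarrow> 'a cspace \<Rightarrow> ('b \<Rightarrow> 'a) \<Rightarrow> 'a set \<Rightarrow> bool" where
  "blow_up X' X \<sigma> A \<longleftrightarrow> monoidal_transformation X' X \<sigma> (ideal_sheaf X A)"

end

theory Submission
  imports Defs
begin

text \<open>
  Over a normal space every holomorphic function \<open>g\<close> on \<open>\<sigma>\<^sup>-\<^sup>1(U)\<close>, for any proper modification
  \<open>\<sigma>\<close>, is the pullback of a holomorphic function on \<open>U\<close>: transport \<open>g\<close> by \<open>\<sigma>\<^sup>-\<^sup>1\<close> to the
  complement of the centre; the result is locally bounded because \<open>\<sigma>\<close> is proper, hence extends by
  normality, and its pullback agrees with \<open>g\<close> on a dense set.  As \<open>\<sigma>\<close> is surjective, the function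
  vanishes on \<open>A\<close> iff its pullback vanishes on \<open>\<sigma>\<^sup>-\<^sup>1(A)\<close>.  Thus pullback is the isomorphism.
\<close>

section \<open>Continuity and the identity principle for holomorphic functions\<close>

lemma complex_space_restrict:
  assumes "complex_space X" "openin (ctop X) U" "openin (ctop X) V" "V \<subseteq> U" "f \<in> hol X U"
  shows "restrict f V \<in> hol X V"
  using assms unfolding complex_space_def by blast

lemma hol_extensional:
  assumes "complex_space X" "openin (ctop X) U" "f \<in> hol X U"
  shows "f \<in> extensional U"
proof -
  have "\<forall>U. openin (ctop X) U \<longrightarrow> hol X U \<subseteq> extensional U"
    using assms(1) unfolding complex_space_def by (elim conjE)
  then show ?thesis using assms(2,3) by blast
qed

text \<open>Continuity of sections is not part of the definition of \<open>complex_space\<close>; it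
  comes from the charts. Near each point a section is \<open>g \<circ> \<phi>\<close> with
  \<open>\<phi>\<close> a chart and \<open>g\<close> satisfying \<open>holo_on\<close>, which
  includes continuity.\<close>

lemma hol_openin_preimage:
  assumes cs: "complex_space X" and U: "openin (ctop X) U" and f: "f \<in> hol X U" and S: "open S"
  shows "openin (ctop X) {x \<in> U. f x \<in> S}"
proof (subst openin_subopen, intro ballI)
  fix x assume "x \<in> {x \<in> U. f x \<in> S}"
  then have x: "x \<in> U" "f x \<in> S" by auto
  then have "x \<in> topspace (ctop X)" using U openin_subset by blast
  moreover have "\<forall>x\<in>topspace (ctop X). \<exists>U n V \<phi>. x \<in> U \<and> chart X U n V \<phi>"
    using cs unfolding complex_space_def by (elim conjE)
  ultimately obtain U0 n V \<phi> where x0: "x \<in> U0" and ch: "chart X U0 n V \<phi>"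
    by blast
  have U0: "openin (ctop X) U0" and lm: "local_model n V"
    and hom: "homeomorphic_map (subtopology (ctop X) U0) (top_of_set V) \<phi>"
    and sec: "\<And>W. openin (ctop X) W \<Longrightarrow> W \<subseteq> U0 \<Longrightarrow>
        hol X W = {f \<in> extensional W. \<forall>x\<in>W. \<exists>D g. \<phi> x \<in> D \<and> holo_on n g D \<and>
                      (\<forall>y\<in>W. \<phi> y \<in> D \<longrightarrow> f y = g (\<phi> y))}"
    using ch unfolding chart_def by blast+
  \<comment> \<open>A chart describes \<open>hol X\<close> only on open subsets of its domain, so
    \<open>f\<close> is first restricted to \<open>U \<inter> U0\<close>.\<close>
  let ?W = "U \<inter> U0"
  have W: "openin (ctop X) ?W" using U U0 by blast
  have "restrict f ?W \<in> hol X ?W"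
    using complex_space_restrict[OF cs U W _ f] by blast
  then obtain D g where D: "\<phi> x \<in> D" "holo_on n g D"
    and fg: "\<forall>y\<in>?W. \<phi> y \<in> D \<longrightarrow> restrict f ?W y = g (\<phi> y)"
    using sec[OF W] x x0 by blast
  have VC: "V \<subseteq> Cn n"
    using lm unfolding local_model_def by (auto dest: openin_imp_subset)
  have oD: "openin (top_of_set (Cn n)) D" and cont: "continuous_on D g"
    using D unfolding holo_on_def by auto
  have "openin (top_of_set D) (D \<inter> g -` S)"
    using cont S by (rule continuous_openin_preimage_gen)
  then have "openin (top_of_set (Cn n)) (D \<inter> g -` S)"
    using oD openin_trans by blast
  \<comment> \<open>\<open>D\<close> is open in \<open>Cn n\<close> and need not lie in the model
    \<open>V\<close>. Passing to an ambient open set \<open>T\<close> allows intersecting with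
    \<open>V\<close>, where \<open>\<phi>\<close> takes its values.\<close>
  then obtain T where T: "open T" "D \<inter> g -` S = Cn n \<inter> T"
    by (auto simp: openin_open)
  have cm: "continuous_map (subtopology (ctop X) U0) (top_of_set V) \<phi>"
    using hom homeomorphic_imp_continuous_map by blast
  have "openin (top_of_set V) (V \<inter> T)" using T by auto
  then have "openin (subtopology (ctop X) U0)
      {y \<in> topspace (subtopology (ctop X) U0). \<phi> y \<in> V \<inter> T}"
    using cm openin_continuous_map_preimage by blast
  then have oQ: "openin (ctop X) {y \<in> topspace (subtopology (ctop X) U0). \<phi> y \<in> V \<inter> T}"
    using U0 openin_trans_full by blast
  let ?Q = "U \<inter> {y \<in> topspace (subtopology (ctop X) U0). \<phi> y \<in> V \<inter> T}"
  have "openin (ctop X) ?Q" using oQ U by blast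
  moreover have "?Q \<subseteq> {x \<in> U. f x \<in> S}"
  proof
    fix y assume y: "y \<in> ?Q"
    then have "\<phi> y \<in> D \<inter> g -` S" using T VC by auto
    then show "y \<in> {x \<in> U. f x \<in> S}" using fg y by auto
  qed
  moreover have "x \<in> ?Q"
  proof -
    have xt: "x \<in> topspace (subtopology (ctop X) U0)"
      using x0 U0 openin_subset by fastforce
    have "\<phi> x \<in> V" using cm xt unfolding continuous_map_def by auto
    moreover have "\<phi> x \<in> D \<inter> g -` S" using D fg x x0 by auto
    ultimately show ?thesis using T xt x by auto
  qed
  ultimately show "\<exists>T. openin (ctop X) T \<and> x \<in> T \<and> T \<subseteq> {x \<in> U. f x \<in> S}" by blast
qed

lemma openin_hol_neq:
  assumes "complex_space X" "openin (ctop X) U" "f \<in> hol X U" "g \<in> hol X U"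
  shows "openin (ctop X) {x \<in> U. f x \<noteq> g x}"
proof (subst openin_subopen, intro ballI)
  fix x assume "x \<in> {x \<in> U. f x \<noteq> g x}"
  then have x: "x \<in> U" and "f x \<noteq> g x" by auto
  then obtain S T where ST: "open S" "open T" "f x \<in> S" "g x \<in> T" "S \<inter> T = {}"
    by (meson separation_t2)
  then have "openin (ctop X) ({x \<in> U. f x \<in> S} \<inter> {x \<in> U. g x \<in> T})"
    using hol_openin_preimage assms by blast
  then show "\<exists>T. openin (ctop X) T \<and> x \<in> T \<and> T \<subseteq> {x \<in> U. f x \<noteq> g x}"
    using ST x by (intro exI[of _ "{x \<in> U. f x \<in> S} \<inter> {x \<in> U. g x \<in> T}"]) auto
qed

text \<open>The points of \<open>U\<close> where \<open>f\<close> and \<open>g\<close> differ form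
  an open set contained in \<open>E\<close>, hence the empty set. Extensionality then upgrades
  agreement on \<open>U\<close> to equality of functions.\<close>

lemma hol_eq_outside_nowhere_dense:
  assumes "complex_space X" "openin (ctop X) U" "f \<in> hol X U" "g \<in> hol X U"
    and "(ctop X) interior_of E = {}" and "\<And>x. x \<in> U - E \<Longrightarrow> f x = g x"
  shows "f = g"
proof -
  have "{x \<in> U. f x \<noteq> g x} \<subseteq> (ctop X) interior_of E"
    using assms(6) by (intro interior_of_maximal openin_hol_neq assms) auto
  then have "\<And>x. x \<in> U \<Longrightarrow> f x = g x" using assms(5) by blast
  then show ?thesis
    using assms hol_extensional by (metis extensionalityI)
qed

section \<open>Rare analytic sets\<close>

lemma openin_complement_analytic_set:
  assumes cs: "complex_space X" and "analytic_set X A"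
  shows "openin (ctop X) (topspace (ctop X) - A)"
proof (subst openin_subopen, intro ballI)
  fix x assume x: "x \<in> topspace (ctop X) - A"
  then obtain U F where U: "openin (ctop X) U" "x \<in> U" and F: "F \<subseteq> hol X U"
    and A: "A \<inter> U = {y\<in>U. \<forall>f\<in>F. f y = 0}"
    using assms(2) unfolding analytic_set_def by blast
  then obtain f where f: "f \<in> F" "f x \<noteq> 0" using x by blast
  have "openin (ctop X) {y \<in> U. f y \<in> - {0}}"
    using f F by (intro hol_openin_preimage cs U) auto
  moreover have "{y \<in> U. f y \<in> - {0}} \<subseteq> topspace (ctop X) - A"
    using f A openin_subset[OF U(1)] by auto
  ultimately show "\<exists>T. openin (ctop X) T \<and> x \<in> T \<and> T \<subseteq> topspace (ctop X) - A"
    using f U by blast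
qed

text \<open>Weak holomorphy on \<open>U\<close> refers to a rare set of the space \<open>U\<close>
  itself, so the centre of a modification has to be cut down to \<open>U\<close>. Local equations
  restrict, and an interior taken in the open set \<open>U\<close> is already open in
  \<open>X\<close>.\<close>

lemma rare_analytic_set_open_subspace:
  assumes cs: "complex_space X" and rare: "rare_analytic_set X N" and U: "openin (ctop X) U"
  shows "rare_analytic_set (open_subspace X U) (N \<inter> U)"
proof -
  have top: "topspace (subtopology (ctop X) U) = U" using U openin_subset by fastforce
  have "\<exists>V F. openin (subtopology (ctop X) U) V \<and> x \<in> V \<and> finite F \<and> F \<subseteq> hol X V \<and>
        N \<inter> U \<inter> V = {y\<in>V. \<forall>f\<in>F. f y = 0}" if x: "x \<in> U" for x
  proof -
    obtain V F where V: "openin (ctop X) V" "x \<in> V" and F: "finite F" "F \<subseteq> hol X V"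
      and N: "N \<inter> V = {y\<in>V. \<forall>f\<in>F. f y = 0}"
    proof -
      have "\<forall>x\<in>topspace (ctop X). \<exists>U F. openin (ctop X) U \<and> x \<in> U \<and> finite F \<and> F \<subseteq> hol X U \<and>
        N \<inter> U = {y\<in>U. \<forall>f\<in>F. f y = 0}"
        using rare unfolding rare_analytic_set_def analytic_set_def by (elim conjE)
      moreover have "x \<in> topspace (ctop X)" using x openin_subset[OF U] by blast
      ultimately show ?thesis using that by meson
    qed
    have VU: "openin (ctop X) (V \<inter> U)" using V U by blast
    have "(\<lambda>f. restrict f (V \<inter> U)) ` F \<subseteq> hol X (V \<inter> U)"
      using F complex_space_restrict[OF cs V(1) VU] by blast
    moreover have "N \<inter> U \<inter> (V \<inter> U) = {y\<in>V \<inter> U. \<forall>f\<in>(\<lambda>f. restrict f (V \<inter> U)) ` F. f y = 0}"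
      using N by auto
    moreover have "openin (subtopology (ctop X) U) (V \<inter> U)"
      using VU U openin_open_subtopology by blast
    ultimately show ?thesis using x V F(1) by (meson IntI finite_imageI)
  qed
  moreover have "subtopology (ctop X) U interior_of (N \<inter> U) = {}"
  proof -
    have "openin (ctop X) (subtopology (ctop X) U interior_of (N \<inter> U))"
      by (rule openin_trans_full[OF openin_interior_of U])
    then have "subtopology (ctop X) U interior_of (N \<inter> U) \<subseteq> (ctop X) interior_of N"
      using interior_of_subset by (intro interior_of_maximal) fastforce+
    then show ?thesis using rare unfolding rare_analytic_set_def by blast
  qed
  ultimately show ?thesis
    unfolding rare_analytic_set_def analytic_set_def using openin_subset[OF U] by (auto simp: open_subspace_def top)
qed

section \<open>Proper modifications over a normal space\<close>

lemma openin_preim: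
  assumes "holomorphic_map Y X \<phi>" "openin (ctop X) U"
  shows "openin (ctop Y) (preim Y \<phi> U)"
  using assms unfolding holomorphic_map_def preim_def
  by (auto intro: openin_continuous_map_preimage)

text \<open>The fibre over \<open>x\<close> is compact, so \<open>g\<close> is bounded by some
  \<open>n\<close> on it. As the map is closed, the open set \<open>cmod (g y) < n\<close> contains
  the full preimage of a neighbourhood of \<open>x\<close>.\<close>

lemma proper_map_locally_bounded:
  assumes Y: "complex_space Y" and proper: "proper_map (ctop Y) (ctop X) \<phi>"
    and surj: "\<phi> ` topspace (ctop Y) = topspace (ctop X)"
    and W: "openin (ctop Y) (preim Y \<phi> U)" and g: "g \<in> hol Y (preim Y \<phi> U)"
    and x: "x \<in> topspace (ctop X)" "x \<in> U"
  shows "\<exists>V M. openin (ctop X) V \<and> x \<in> V \<and> V \<subseteq> U \<and> (\<forall>y\<in>preim Y \<phi> V. cmod (g y) \<le> M)"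
proof -
  define O' where "O' n = {y \<in> preim Y \<phi> U. g y \<in> ball 0 (real n)}" for n
  have oO: "openin (ctop Y) (O' n)" for n
    unfolding O'_def by (intro hol_openin_preimage Y W g) auto
  let ?K = "{y \<in> topspace (ctop Y). \<phi> y = x}"
  have "compactin (ctop Y) ?K" using proper x unfolding proper_map_def by blast
  moreover have "?K \<subseteq> \<Union> (range O')"
  proof
    fix y assume y: "y \<in> ?K"
    obtain n where "cmod (g y) < real n" using reals_Archimedean2 by blast
    then show "y \<in> \<Union> (range O')" using y x by (auto simp: O'_def preim_def)
  qed
  ultimately obtain \<F> where F: "finite \<F>" "\<F> \<subseteq> range O'" "?K \<subseteq> \<Union> \<F>"
    using oO compactinD[of "ctop Y" ?K "range O'"] by blast
  then obtain I where I: "finite I" "\<F> = O' ` I" by (meson finite_subset_image)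
  \<comment> \<open>The sets \<open>O' n\<close> increase with \<open>n\<close>, so a single one
    contains the finite subcover. Inserting \<open>0\<close> keeps \<open>Max\<close> meaningful
    when \<open>I\<close> is empty.\<close>
  have mono: "O' i \<subseteq> O' (Max (insert 0 I))" if "i \<in> I" for i
  proof -
    have "i \<le> Max (insert 0 I)" using that I by simp
    then have "real i \<le> real (Max (insert 0 I))" by simp
    then show ?thesis unfolding O'_def by auto
  qed
  have "?K \<subseteq> (\<Union>i\<in>I. O' i)" using F(3) I(2) by simp
  also have "\<dots> \<subseteq> O' (Max (insert 0 I))" using mono by (rule UN_least)
  finally obtain n where n: "?K \<subseteq> O' n" by (rule that)
  have "closed_map (ctop Y) (ctop X) \<phi>" using proper unfolding proper_map_def by blast
  then have cl: "closedin (ctop X) (\<phi> ` (topspace (ctop Y) - O' n))"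
    using oO[of n] unfolding closed_map_def by blast
  let ?V = "topspace (ctop X) - \<phi> ` (topspace (ctop Y) - O' n)"
  have "openin (ctop X) ?V" using cl by blast
  moreover have "x \<in> ?V" using x n by blast
  moreover have "preim Y \<phi> ?V \<subseteq> O' n" by (auto simp: preim_def)
  \<comment> \<open>By surjectivity each \<open>v\<close> in \<open>?V\<close> has a point above it;
    that point lies in \<open>O' n\<close>, hence over \<open>U\<close>.\<close>
  moreover have "?V \<subseteq> U"
  proof
    fix v assume v: "v \<in> ?V"
    then have "v \<in> \<phi> ` topspace (ctop Y)" using surj by simp
    then obtain y where "y \<in> topspace (ctop Y)" "\<phi> y = v" by (elim imageE) simp
    then have "y \<in> O' n" using v by blast
    then show "v \<in> U" using \<open>\<phi> y = v\<close> by (auto simp: O'_def preim_def)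
  qed
  moreover have "\<forall>y\<in>O' n. cmod (g y) \<le> real n" by (auto simp: O'_def)
  ultimately show ?thesis by blast
qed

lemma proper_modification_hol_eq_pull:
  assumes nX: "normal_complex_space X" and pm: "proper_modification Y X \<phi>"
    and U: "openin (ctop X) U" and g: "g \<in> hol Y (preim Y \<phi> U)"
  obtains f where "f \<in> hol X U" "pull Y \<phi> U f = g"
proof -
  have Y: "complex_space Y" and X: "complex_space X" and hm: "holomorphic_map Y X \<phi>"
    and proper: "proper_map (ctop Y) (ctop X) \<phi>"
    and surj: "\<phi> ` topspace (ctop Y) = topspace (ctop X)"
    using pm unfolding proper_modification_def by auto
  obtain E N where E: "rare_analytic_set Y E" and N: "rare_analytic_set X N"
    and bihol: "biholomorphic_map (open_subspace Y (topspace (ctop Y) - E))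
                          (open_subspace X (topspace (ctop X) - N)) \<phi>"
    using pm unfolding proper_modification_def by auto
  let ?Y = "topspace (ctop Y) - E" and ?X = "topspace (ctop X) - N"
  obtain \<psi> where \<psi>: "holomorphic_map (open_subspace X ?X) (open_subspace Y ?Y) \<psi>"
    and \<psi>\<phi>: "\<And>y. y \<in> ?Y \<Longrightarrow> \<psi> (\<phi> y) = y" and \<phi>\<psi>: "\<And>x. x \<in> ?X \<Longrightarrow> \<phi> (\<psi> x) = x"
    using bihol unfolding biholomorphic_map_def by (auto simp: open_subspace_def)
  have \<psi>Y: "\<psi> x \<in> ?Y" if "x \<in> ?X" for x
    using \<psi> that unfolding holomorphic_map_def continuous_map_def
    by (auto simp: open_subspace_def)
  have \<phi>X: "\<phi> y \<in> ?X" if "y \<in> ?Y" for y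
    using bihol that unfolding biholomorphic_map_def holomorphic_map_def continuous_map_def
    by (auto simp: open_subspace_def)
  have oY: "openin (ctop Y) ?Y"
    using E Y openin_complement_analytic_set unfolding rare_analytic_set_def by blast
  have W: "openin (ctop Y) (preim Y \<phi> U)" using openin_preim hm U by blast
  have UX: "U \<subseteq> topspace (ctop X)" using U openin_subset by blast
  let ?P = "preim Y \<phi> U \<inter> ?Y"
  have oP: "openin (ctop Y) ?P" using W oY by blast
  have gP: "restrict g ?P \<in> hol Y ?P"
    using complex_space_restrict[OF Y W oP _ g] by blast
  \<comment> \<open>\<open>\<psi>\<close> maps the complement of \<open>N\<close> into the
    complement of \<open>E\<close>, and \<open>\<phi> (\<psi> x) = x\<close>, so
    \<open>\<psi> x\<close> lies over \<open>U\<close> exactly when \<open>x\<close> is in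
    \<open>U\<close>.\<close>
  have pre: "preim (open_subspace X ?X) \<psi> ?P = U - N"
    using UX \<psi>Y \<phi>\<psi> by (auto simp: preim_def open_subspace_def)
  have "openin (ctop (open_subspace Y ?Y)) ?P" "restrict g ?P \<in> hol (open_subspace Y ?Y) ?P"
    using oP oY gP by (auto simp: open_subspace_def openin_open_subtopology)
  then have "pull (open_subspace X ?X) \<psi> ?P (restrict g ?P)
      \<in> hol (open_subspace X ?X) (preim (open_subspace X ?X) \<psi> ?P)"
    using \<psi> unfolding holomorphic_map_def by blast
  then have hol: "pull (open_subspace X ?X) \<psi> ?P (restrict g ?P) \<in> hol X (U - N)"
    unfolding pre by (simp add: open_subspace_def)
  define h where "h = pull (open_subspace X ?X) \<psi> ?P (restrict g ?P)"
  have h: "h x = g (\<psi> x)" if "x \<in> U - N" for x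
  proof -
    have "\<psi> x \<in> ?P" using that pre by (auto simp: preim_def)
    then show ?thesis unfolding h_def pull_def pre using that by simp
  qed
  \<comment> \<open>The point \<open>\<psi> y\<close> lies over \<open>y\<close>, so a bound for
    \<open>g\<close> on the preimage of \<open>V\<close> bounds \<open>h\<close> on \<open>V\<close>
    off the centre.\<close>
  have bd: "\<exists>V M. openin (ctop X) V \<and> x \<in> V \<and> V \<subseteq> U \<and> (\<forall>y\<in>V - N \<inter> U. cmod (h y) \<le> M)"
    if xU: "x \<in> U" for x
  proof -
    obtain V M where V: "openin (ctop X) V" "x \<in> V" "V \<subseteq> U"
      and M: "\<forall>y\<in>preim Y \<phi> V. cmod (g y) \<le> M"
      using proper_map_locally_bounded[OF Y proper surj W g subsetD[OF UX xU] xU]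
      by (elim exE conjE)
    have "cmod (h y) \<le> M" if y: "y \<in> V - N \<inter> U" for y
    proof -
      have "y \<in> U - N" "y \<in> ?X" using y V UX by auto
      moreover from this have "\<psi> y \<in> preim Y \<phi> V"
        using \<psi>Y[of y] \<phi>\<psi>[of y] y by (auto simp: preim_def)
      ultimately show ?thesis using M h by simp
    qed
    then show ?thesis using V by blast
  qed
  have "weakly_holomorphic X U (N \<inter> U) h"
    unfolding weakly_holomorphic_def
    using rare_analytic_set_open_subspace[OF X N U] hol bd
    by (simp add: h_def Diff_Int_distrib2 Diff_Int)
  then obtain f where f: "f \<in> hol X U" and fh: "\<forall>y\<in>U - N \<inter> U. f y = h y"
    using nX U unfolding normal_complex_space_def by blast
  \<comment> \<open>Off \<open>E\<close> the point \<open>\<phi> y\<close> avoids \<open>N\<close>,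
    so \<open>f (\<phi> y) = h (\<phi> y) = g (\<psi> (\<phi> y)) = g y\<close>. The identity
    principle carries this across \<open>E\<close>.\<close>
  have "pull Y \<phi> U f = g"
  proof (rule hol_eq_outside_nowhere_dense[OF Y W _ g])
    show "pull Y \<phi> U f \<in> hol Y (preim Y \<phi> U)"
      using hm U f unfolding holomorphic_map_def by blast
    show "(ctop Y) interior_of E = {}" using E unfolding rare_analytic_set_def by blast
    fix y assume y: "y \<in> preim Y \<phi> U - E"
    then have "y \<in> ?Y" "\<phi> y \<in> U - N" using \<phi>X[of y] by (auto simp: preim_def)
    then show "pull Y \<phi> U f y = g y"
      using y fh h \<psi>\<phi> by (simp add: pull_def)
  qed
  then show thesis using f that by blast
qed

section \<open>The direct image of the ideal sheaf\<close>

theorem proper_modification_direct_image_ideal_sheaf: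
  assumes nX: "normal_complex_space X" and pm: "proper_modification Y X \<phi>"
  shows "sheaf_isomorphism X (ideal_sheaf X A)
    (direct_image Y \<phi> (ideal_sheaf Y (preim Y \<phi> A))) (pull Y \<phi>)"
proof -
  have Y: "complex_space Y" and X: "complex_space X" and hm: "holomorphic_map Y X \<phi>"
    and surj: "\<phi> ` topspace (ctop Y) = topspace (ctop X)"
    using pm unfolding proper_modification_def by auto
  have bij: "bij_betw (pull Y \<phi> U) (ideal_sections X A U)
      (ideal_sections Y (preim Y \<phi> A) (preim Y \<phi> U))" if U: "openin (ctop X) U" for U
  proof -
    have UX: "U \<subseteq> topspace (ctop X)" using U openin_subset by blast
    \<comment> \<open>Points above \<open>x\<close> serve twice: they make pullback injective, and
      they carry vanishing on \<open>preim Y \<phi> A\<close> down to \<open>A\<close>.\<close>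
    have lift: "\<exists>y\<in>preim Y \<phi> U. \<phi> y = x" if "x \<in> U" for x
      using that UX surj unfolding preim_def by force
    have "inj_on (pull Y \<phi> U) (hol X U)"
    proof (rule inj_onI)
      fix f g assume fg: "f \<in> hol X U" "g \<in> hol X U" and eq: "pull Y \<phi> U f = pull Y \<phi> U g"
      have "f x = g x" if xU: "x \<in> U" for x
      proof -
        obtain y where "y \<in> preim Y \<phi> U" "\<phi> y = x" using lift[OF xU] by blast
        then show ?thesis using fun_cong[OF eq, of y] by (simp add: pull_def)
      qed
      then show "f = g" using fg hol_extensional[OF X U] by (meson extensionalityI)
    qed
    then have "inj_on (pull Y \<phi> U) (ideal_sections X A U)"
      by (rule inj_on_subset) (auto simp: ideal_sections_def)
    moreover have "pull Y \<phi> U f \<in> ideal_sections Y (preim Y \<phi> A) (preim Y \<phi> U)"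
      if "f \<in> ideal_sections X A U" for f
      using that hm U unfolding holomorphic_map_def ideal_sections_def
      by (auto simp: pull_def preim_def)
    moreover have "g \<in> pull Y \<phi> U ` ideal_sections X A U"
      if g: "g \<in> ideal_sections Y (preim Y \<phi> A) (preim Y \<phi> U)" for g
    proof -
      obtain f where f: "f \<in> hol X U" "pull Y \<phi> U f = g"
        using proper_modification_hol_eq_pull[OF nX pm U] g unfolding ideal_sections_def by blast
      have "f x = 0" if x: "x \<in> U \<inter> A" for x
      proof -
        obtain y where y: "y \<in> preim Y \<phi> U" "\<phi> y = x" using lift x by blast
        then have "g y = 0" using g x unfolding ideal_sections_def by (auto simp: preim_def)
        then show ?thesis using y f by (auto simp: pull_def)
      qed
      then show ?thesis using f unfolding ideal_sections_def by blast
    qed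
    ultimately show ?thesis unfolding bij_betw_def by blast
  qed
  show ?thesis
    unfolding sheaf_isomorphism_def
  \<comment> \<open>The cases are bijectivity, additivity, linearity and restriction. The last three
    hold pointwise, because \<open>pull\<close> is composition with \<open>\<phi>\<close> and
    scalars act on the direct image through their pullbacks.\<close>
  proof (intro allI impI conjI ballI, goal_cases)
    case (1 U)
    then show ?case
      using bij by (simp add: ideal_sheaf_def direct_image_def structure_sheaf_def Let_def)
  next
    case (2 U s t)
    then show ?case
      by (auto simp: ideal_sheaf_def direct_image_def structure_sheaf_def Let_def pull_def preim_def)
  next
    case (3 U f s)
    then show ?case
      by (auto simp: ideal_sheaf_def direct_image_def structure_sheaf_def Let_def pull_def preim_def)
  next
    case (4 U V s)
    then show ?case
      by (auto simp: ideal_sheaf_def direct_image_def structure_sheaf_def Let_def pull_def preim_def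
          restrict_def fun_eq_iff)
  qed
qed

theorem lemma7p3:
  fixes X :: "'a cspace" and X' :: "'b cspace" and \<sigma> :: "'b \<Rightarrow> 'a" and A :: "'a set"
    and B :: "'b set"
  assumes "normal_complex_space X"
    and "rare_analytic_set X A"
    and "locally_complete_intersection X A \<or> normal_complex_space (reduced_subspace X A)"
    and "blow_up X' X \<sigma> A"
    and "B = preim X' \<sigma> A"
  shows "sheaf_isomorphic X (ideal_sheaf X A) (direct_image X' \<sigma> (ideal_sheaf X' B))"
proof -
  have "proper_modification X' X \<sigma>"
    using assms(4) unfolding blow_up_def monoidal_transformation_def by blast
  then show ?thesis
    using proper_modification_direct_image_ideal_sheaf[OF assms(1)] assms(5)
    unfolding sheaf_isomorphic_def by blast
qed

end
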